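(* Let $S=(s_n)$ be a good sequence and let $\alpha$ be an irrational number. Then the limit Borel probability measure $\mu_{S,\alpha}=\lim_{N\to\infty}\frac1N\sum_{n=1}^N\delta_{s_n\alpha}$ on $\mathbb{T}$ is a continuous measure, i.e. $\mu_{S,\alpha}(\{\gamma\})=0$ for every $\gamma\in\mathbb{T}$.
   Context: $\mathbb{T}=\mathbb{R}/\mathbb{Z}$ and $e(\beta)=e^{2\pi i\beta}$. Sequences $S=(s_n)_{n\ge1}$ are strictly increasing sequences of positive integers. Such a sequence is good if $\lim_{N\to\infty}\frac1N\sum_{n=1}^N e(s_n\alpha)$ exists for every real number $\alpha$; in that case, for every $\alpha$, the weak limit $\mu_{S,\alpha}:=\lim_{N\to\infty}\frac1N\sum_{n=1}^N\delta_{s_n\alpha}$ of probability measures on $\mathbb{T}$ exists (with $s_n\alpha$ taken mod $1$). *)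

theory Defs
  imports "HOL-Probability.Probability"
begin

quotient_type circle = real / "\<lambda>x y. x - y \<in> \<int>"
  morphisms rep_circle mod_one
proof (rule equivpI)
  show "reflp (\<lambda>x y::real. x - y \<in> \<int>)"
    by (simp add: reflp_def)
  show "symp (\<lambda>x y::real. x - y \<in> \<int>)"
    by (rule sympI, drule Ints_minus) simp
  show "transp (\<lambda>x y::real. x - y \<in> \<int>)"
    by (rule transpI, drule (1) Ints_add) simp
qed

text \<open>The circle carries the quotient topology.\<close>

instantiation circle :: topological_space
begin

definition open_circle :: "circle set \<Rightarrow> bool" where
  "open_circle U \<longleftrightarrow> open (mod_one -` U)"

instance
  by standard (auto simp: open_circle_def vimage_Union)

end

lemma closed_circle_singleton: "closed {\<gamma> :: circle}"
proof -
  obtain x where x: "\<gamma> = mod_one x"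
    by (metis Quotient3_abs_rep Quotient3_circle)
  have "mod_one -` {\<gamma>} = (\<lambda>y. y - x) -` \<int>"
    by (auto simp: x circle.abs_eq_iff)
  moreover have "closed ((\<lambda>y. y - x) -` \<int>)"
    by (intro closed_vimage closed_Ints continuous_intros)
  ultimately show ?thesis
    by (simp add: closed_def open_circle_def vimage_Compl)
qed

definition unit_exp :: "real \<Rightarrow> complex" where
  "unit_exp \<beta> = exp (2 * of_real pi * \<i> * of_real \<beta>)"

text \<open>Sequences are indexed from 1; the value at 0 is irrelevant throughout.\<close>

definition increasing_pos_seq :: "(nat \<Rightarrow> nat) \<Rightarrow> bool" where
  "increasing_pos_seq s \<longleftrightarrow> strict_mono_on {1..} s \<and> (\<forall>n\<ge>1. 0 < s n)"

definition good :: "(nat \<Rightarrow> nat) \<Rightarrow> bool" where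
  "good s \<longleftrightarrow>
     (\<forall>\<alpha>::real. convergent (\<lambda>N. (1 / of_nat N) * (\<Sum>n=1..N. unit_exp (of_nat (s n) * \<alpha>))))"

text \<open>The measure \<open>(1/N) \<Sum>\<^sub>n\<^sub>\<le>\<^sub>N \<delta>\<close> with point masses at \<open>s n * \<alpha>\<close> modulo 1, for \<open>N \<ge> 1\<close>
  (it is the zero measure for \<open>N = 0\<close>).\<close>

definition empirical_measure :: "(nat \<Rightarrow> nat) \<Rightarrow> real \<Rightarrow> nat \<Rightarrow> circle measure" where
  "empirical_measure s \<alpha> N =
     distr (uniform_count_measure {1..N}) borel (\<lambda>n. mod_one (of_nat (s n) * \<alpha>))"

lemma integral_empirical_measure:
  fixes f :: "circle \<Rightarrow> real"
  assumes "continuous_on UNIV f"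
  shows "(\<integral>x. f x \<partial>empirical_measure s \<alpha> N) =
    (1 / of_nat N) * (\<Sum>n=1..N. f (mod_one (of_nat (s n) * \<alpha>)))"
proof -
  have "f \<in> borel_measurable borel"
    using assms by (rule borel_measurable_continuous_onI)
  then have "(\<integral>x. f x \<partial>empirical_measure s \<alpha> N) =
      (\<integral>n. f (mod_one (of_nat (s n) * \<alpha>)) \<partial>uniform_count_measure {1..N})"
    unfolding empirical_measure_def
    by (intro integral_distr) (simp_all add: measurable_def space_uniform_count_measure sets_uniform_count_measure)
  also have "\<dots> = (1 / of_nat N) * (\<Sum>n=1..N. f (mod_one (of_nat (s n) * \<alpha>)))"
    by (simp add: integral_uniform_count_measure)
  finally show ?thesis .
qed

text \<open>Since the circle is compact, all continuous test functions are bounded.\<close>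

definition converges_weakly :: "(nat \<Rightarrow> circle measure) \<Rightarrow> circle measure \<Rightarrow> bool" where
  "converges_weakly M \<mu> \<longleftrightarrow>
     (\<forall>f :: circle \<Rightarrow> real. continuous_on UNIV f \<longrightarrow>
        (\<lambda>N. \<integral>x. f x \<partial>M N) \<longlonglongrightarrow> (\<integral>x. f x \<partial>\<mu>))"

definition limit_measure :: "(nat \<Rightarrow> nat) \<Rightarrow> real \<Rightarrow> circle measure" where
  "limit_measure s \<alpha> =
     (THE \<mu>. prob_space \<mu> \<and> sets \<mu> = sets borel \<and> converges_weakly (empirical_measure s \<alpha>) \<mu>)"

end

theory Submission
  imports Defs
begin

text \<open>
  Suppose that \<open>\<gamma> = mod_one c\<close> were an atom of mass \<open>a > 0\<close>. Weight the sequence by a trigonometric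
  polynomial \<open>g\<close> of modulus at most 1 (a normalised Dirichlet kernel, \<open>peak\<close>) that approximates the
  indicator of \<open>\<gamma>\<close> in mean with respect to the limit measure, and consider the means
  \<open>F N \<beta> = 1/N * (\<Sum>n=1..N. g (s n * \<alpha>) * unit_exp (s n * \<beta>))\<close>. Since \<open>g\<close> is a trigonometric
  polynomial, goodness of the sequence makes \<open>F N \<beta>\<close> converge for every real \<open>\<beta>\<close>.

  At \<open>\<beta> = k * \<alpha>\<close> the limit is the integral of \<open>g\<close> times the \<open>k\<close>-th character. As \<open>g\<close> is close to the
  indicator of \<open>\<gamma>\<close>, this is \<open>a * unit_exp (k * c)\<close> up to an error bounded independently of \<open>k\<close>
  (\<open>norm_integral_peak_char_ge\<close>). So the limit function has modulus greater than \<open>a/2\<close> at all points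
  \<open>k * \<alpha> - h\<close> with integers \<open>k, h\<close>, and these are dense because \<open>\<alpha>\<close> is irrational.

  On the other hand, the integral of \<open>F N\<close> over any bounded interval tends to 0 because the \<open>s n\<close> grow.
  An everywhere convergent sequence of continuous functions is, by Baire's theorem, uniformly Cauchy up to a
  given error on some interval; together these facts forbid the limit from being bounded away from 0 on a
  dense set (\<open>weighted_mean_limit_small_on_dense\<close>), a contradiction.

  The limit measure is given by a definite description, so its existence and uniqueness come first
  (\<open>limit_measure_props\<close>): existence by Helly selection on the unit interval together with
  Stone--Weierstrass, uniqueness by approximating indicators of open sets by continuous functions.
\<close>

section \<open>The unit exponential\<close>

lemma unit_exp_cis: "unit_exp x = cis (2 * pi * x)"
  by (simp add: unit_exp_def cis_conv_exp mult_ac)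

lemma unit_exp_0 [simp]: "unit_exp 0 = 1"
  by (simp add: unit_exp_cis)

lemma unit_exp_add: "unit_exp (x + y) = unit_exp x * unit_exp y"
  by (simp add: unit_exp_cis cis_mult ring_distribs)

lemma norm_unit_exp [simp]: "norm (unit_exp x) = 1"
  by (simp add: unit_exp_cis)

lemma unit_exp_eq_1_iff: "unit_exp x = 1 \<longleftrightarrow> x \<in> \<int>"
proof -
  have "unit_exp x = 1 \<longleftrightarrow> (\<exists>n::int. 2 * pi * x = 2 * pi * of_int n)"
    unfolding unit_exp_def exp_eq_1 by (auto simp: mult_ac)
  then show ?thesis
    by (auto simp: Ints_def)
qed

lemma unit_exp_minus: "unit_exp (- x) = inverse (unit_exp x)"
  by (simp add: unit_exp_cis)

lemma unit_exp_eq_iff: "unit_exp x = unit_exp y \<longleftrightarrow> x - y \<in> \<int>"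
proof -
  have "unit_exp (x - y) = unit_exp x * inverse (unit_exp y)"
    using unit_exp_add[of x "- y"] by (simp add: unit_exp_minus)
  then have "unit_exp x = unit_exp y \<longleftrightarrow> unit_exp (x - y) = 1"
    by (metis norm_unit_exp norm_zero right_inverse unit_exp_add unit_exp_minus 
        diff_add_cancel mult_1 zero_neq_one)
  then show ?thesis by (simp add: unit_exp_eq_1_iff)
qed

lemma unit_exp_of_nat_mult: "unit_exp (of_nat n * x) = unit_exp x ^ n"
  by (induction n) (simp_all add: unit_exp_add ring_distribs)

lemma continuous_on_unit_exp [continuous_intros]:
  "continuous_on A f \<Longrightarrow> continuous_on A (\<lambda>x. unit_exp (f x))"
  unfolding unit_exp_def by (intro continuous_intros)

section \<open>Integrals of exponential means\<close>

lemma norm_integral_unit_exp_le: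
  assumes "a \<le> b" "r \<ge> 1"
  shows "norm (integral {a..b} (\<lambda>\<beta>. unit_exp (r * \<beta>))) \<le> 1 / r"
proof -
  define c :: complex where "c = 2 * of_real pi * \<i> * of_real r"
  have c: "c \<noteq> 0" and nc: "norm c = 2 * pi * r"
    using assms by (auto simp: c_def norm_mult)
  have "((\<lambda>\<beta>. unit_exp (r * \<beta>)) has_integral (unit_exp (r * b) / c - unit_exp (r * a) / c)) {a..b}"
  proof (rule fundamental_theorem_of_calculus[OF assms(1)])
    fix x assume "x \<in> {a..b}"
    have "((\<lambda>z. exp (c * z) / c) has_field_derivative exp (c * of_real x)) (at (of_real x))"
      using c by (auto intro!: derivative_eq_intros)
    from has_vector_derivative_real_field[OF this]
    show "((\<lambda>\<beta>. unit_exp (r * \<beta>) / c) has_vector_derivative unit_exp (r * x)) (at x within {a..b})"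
      by (simp add: unit_exp_def c_def mult_ac)
  qed
  then have "integral {a..b} (\<lambda>\<beta>. unit_exp (r * \<beta>)) = unit_exp (r * b) / c - unit_exp (r * a) / c"
    by (rule integral_unique)
  also have "norm \<dots> \<le> norm (unit_exp (r * b) / c) + norm (unit_exp (r * a) / c)"
    by (rule norm_triangle_ineq4)
  also have "\<dots> = 2 / (2 * pi * r)"
    using nc by (simp add: norm_divide)
  also have "\<dots> \<le> 1 / r"
    using assms pi_gt3 by (simp add: field_simps)
  finally show ?thesis .
qed

lemma harm_mean_tendsto_0: "(\<lambda>N. (1 / real N) * harm N) \<longlonglongrightarrow> 0"
proof -
  have "(\<lambda>N. 1 / real N * (harm N - ln (real N)) + ln (real N) / real N) \<longlonglongrightarrow> 0 * euler_mascheroni + 0"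
    by (intro tendsto_intros euler_mascheroni_LIMSEQ lim_1_over_n lim_ln_over_n)
  then show ?thesis by (simp add: ring_distribs)
qed

definition weighted_mean :: "(nat \<Rightarrow> complex) \<Rightarrow> (nat \<Rightarrow> nat) \<Rightarrow> nat \<Rightarrow> real \<Rightarrow> complex" where
  "weighted_mean w s N \<beta> = (1 / of_nat N) * (\<Sum>n=1..N. w n * unit_exp (of_nat (s n) * \<beta>))"

lemma continuous_on_weighted_mean: "continuous_on A (weighted_mean w s N)"
  unfolding weighted_mean_def by (intro continuous_intros)

text \<open>Since \<open>s n \<ge> n\<close>, the \<open>n\<close>-th summand integrates to at most \<open>1/n\<close>, and the mean of the first \<open>N\<close>
  terms of the harmonic series tends to 0. The weights enter only through their size.\<close>

lemma integral_weighted_mean_tendsto_0: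
  assumes w: "\<And>n. norm (w n) \<le> 1" and s: "\<And>n. n \<ge> 1 \<Longrightarrow> n \<le> s n" and "a \<le> b"
  shows "(\<lambda>N. integral {a..b} (weighted_mean w s N)) \<longlonglongrightarrow> 0"
proof (rule Lim_null_comparison[OF _ harm_mean_tendsto_0], rule always_eventually, rule allI)
  fix N
  have int: "(\<lambda>\<beta>. unit_exp (of_nat (s n) * \<beta>)) integrable_on {a..b}" for n
    by (intro integrable_continuous_real continuous_intros)
  have "integral {a..b} (weighted_mean w s N) =
      (1 / of_nat N) * (\<Sum>n=1..N. w n * integral {a..b} (\<lambda>\<beta>. unit_exp (of_nat (s n) * \<beta>)))"
    unfolding weighted_mean_def
    by (simp only: integral_mult_right, subst integral_sum) (auto intro: integrable_on_mult_right int)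
  also have "norm \<dots> = (1 / real N) * norm (\<Sum>n=1..N. w n * integral {a..b} (\<lambda>\<beta>. unit_exp (of_nat (s n) * \<beta>)))"
    by (simp add: norm_mult norm_divide)
  also have "\<dots> \<le> (1 / real N) * (\<Sum>n=1..N. inverse (real n))"
  proof (intro mult_left_mono sum_norm_le)
    fix n assume n: "n \<in> {1..N}"
    have "norm (w n * integral {a..b} (\<lambda>\<beta>. unit_exp (of_nat (s n) * \<beta>))) \<le> 1 * (1 / real (s n))"
      unfolding norm_mult using n s[of n]
      by (intro mult_mono w norm_integral_unit_exp_le \<open>a \<le> b\<close>) auto
    also have "\<dots> \<le> inverse (real n)"
      using n s[of n] by (auto simp: field_simps)
    finally show "norm (w n * integral {a..b} (\<lambda>\<beta>. unit_exp (of_nat (s n) * \<beta>))) \<le> inverse (real n)" .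
  qed auto
  finally show "norm (integral {a..b} (weighted_mean w s N)) \<le> (1 / real N) * harm N"
    by (simp add: harm_def)
qed

section \<open>Limits of exponential means cannot be large on a dense set\<close>

text \<open>By pointwise convergence the closed sets on which all \<open>F m\<close>, \<open>F n\<close> with \<open>m, n \<ge> N\<close> differ by at most
  \<open>\<epsilon>\<close> cover the space, so by Baire's theorem one of them has interior. This yields almost uniform
  control on some open set although the limit function may be discontinuous at many points.\<close>

lemma pointwise_convergent_imp_uniformly_Cauchy_on_open:
  fixes F :: "nat \<Rightarrow> 'a::euclidean_space \<Rightarrow> 'b::real_normed_vector"
  assumes cont: "\<And>n. continuous_on UNIV (F n)"
    and conv: "\<And>x. convergent (\<lambda>n. F n x)" and "\<epsilon> > 0"
  obtains N U where "open U" "U \<noteq> {}"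
    "\<And>x m n. x \<in> U \<Longrightarrow> m \<ge> N \<Longrightarrow> n \<ge> N \<Longrightarrow> norm (F m x - F n x) \<le> \<epsilon>"
proof -
  define E where "E N = {x. \<forall>m\<ge>N. \<forall>n\<ge>N. norm (F m x - F n x) \<le> \<epsilon>}" for N
  have "closed (E N)" for N
    unfolding E_def by (intro closed_Collect_all closed_Collect_imp closed_Collect_le
        open_Collect_const continuous_intros cont)
  have cover: "\<exists>N. x \<in> E N" for x
  proof -
    have "Cauchy (\<lambda>n. F n x)" using conv by (rule convergent_Cauchy)
    then obtain N where "\<forall>m\<ge>N. \<forall>n\<ge>N. norm (F m x - F n x) < \<epsilon>"
      using \<open>\<epsilon> > 0\<close> by (meson CauchyD)
    then show ?thesis unfolding E_def by (intro exI[of _ N]) (auto intro: less_imp_le)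
  qed
  have "\<exists>N. interior (E N) \<noteq> {}"
  proof (rule ccontr)
    assume "\<nexists>N. interior (E N) \<noteq> {}"
    then have "UNIV \<subseteq> closure (\<Inter>N. - E N)"
      using \<open>\<And>N. closed (E N)\<close>
      by (intro Baire) (auto simp: closure_complement)
    then have "(\<Inter>N. - E N) \<noteq> {}" by auto
    with cover show False by auto
  qed
  then obtain N where "interior (E N) \<noteq> {}" by blast
  then show ?thesis
    by (intro that[of "interior (E N)" N]) (use interior_subset[of "E N"] in \<open>auto simp: E_def\<close>)
qed

lemma norm_limit_diff_le:
  fixes l z :: "'a::real_normed_vector"
  assumes "X \<longlonglongrightarrow> l" "\<And>n. n \<ge> N \<Longrightarrow> norm (X n - z) \<le> c"
  shows "norm (l - z) \<le> c"
  using assms by (intro LIMSEQ_le_const2[OF tendsto_norm[OF tendsto_diff[OF _ tendsto_const]]]) auto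

text \<open>If the limit were at least \<open>\<epsilon>\<close> in modulus at all points of \<open>D\<close>, then, on an open set where the means are
  uniformly Cauchy up to \<open>\<epsilon>/4\<close>, continuity of a single mean would spread its value \<open>z\<close> at a point of \<open>D\<close>
  to an interval on which every later mean stays within \<open>\<epsilon>/2\<close> of \<open>z\<close>. Because \<open>\<bar>z\<bar> \<ge> 3\<epsilon>/4\<close>, the integrals
  of these means over that interval could not tend to 0.\<close>

lemma weighted_mean_limit_small_on_dense:
  assumes w: "\<And>n. norm (w n) \<le> 1" and s: "\<And>n. n \<ge> 1 \<Longrightarrow> n \<le> s n"
    and conv: "\<And>\<beta>. convergent (\<lambda>N. weighted_mean w s N \<beta>)"
    and dense: "closure D = UNIV" and "\<epsilon> > 0"
  shows "\<exists>\<beta>\<in>D. norm (lim (\<lambda>N. weighted_mean w s N \<beta>)) < \<epsilon>"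
proof (rule ccontr)
  assume "\<not> ?thesis"
  then have large: "norm (lim (\<lambda>N. weighted_mean w s N \<beta>)) \<ge> \<epsilon>" if "\<beta> \<in> D" for \<beta>
    using that by force
  define F where "F = weighted_mean w s"
  obtain N U where U: "open U" "U \<noteq> {}"
    and Cauchy: "\<And>\<beta> m n. \<beta> \<in> U \<Longrightarrow> m \<ge> N \<Longrightarrow> n \<ge> N \<Longrightarrow> norm (F m \<beta> - F n \<beta>) \<le> \<epsilon> / 4"
    by (rule pointwise_convergent_imp_uniformly_Cauchy_on_open[of F "\<epsilon> / 4"])
      (use conv \<open>\<epsilon> > 0\<close> continuous_on_weighted_mean in \<open>auto simp: F_def\<close>)
  have "D \<inter> U \<noteq> {}"
    using U dense by (metis Int_UNIV_right open_Int_closure_eq_empty inf_commute)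
  then obtain \<beta>\<^sub>0 where \<beta>\<^sub>0: "\<beta>\<^sub>0 \<in> D" "\<beta>\<^sub>0 \<in> U" by blast
  define z where "z = F N \<beta>\<^sub>0"
  have "(\<lambda>n. F n \<beta>\<^sub>0) \<longlonglongrightarrow> lim (\<lambda>n. F n \<beta>\<^sub>0)"
    using conv by (simp add: F_def convergent_LIMSEQ_iff)
  then have "norm (lim (\<lambda>n. F n \<beta>\<^sub>0) - z) \<le> \<epsilon> / 4"
    unfolding z_def by (rule norm_limit_diff_le[where N = N]) (rule Cauchy[OF \<beta>\<^sub>0(2)], simp_all)
  moreover have "norm (lim (\<lambda>n. F n \<beta>\<^sub>0)) \<ge> \<epsilon>"
    using large[OF \<beta>\<^sub>0(1)] by (simp add: F_def)
  moreover have "norm (lim (\<lambda>n. F n \<beta>\<^sub>0)) \<le> norm (lim (\<lambda>n. F n \<beta>\<^sub>0) - z) + norm z"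
    by (metis diff_add_cancel norm_triangle_ineq)
  ultimately have z: "norm z \<ge> 3 * \<epsilon> / 4" by linarith
  have "open (U \<inter> F N -` ball z (\<epsilon> / 4))"
    using U continuous_on_weighted_mean[of UNIV w s N]
    by (auto intro!: open_Int open_vimage simp: F_def)
  moreover have "\<beta>\<^sub>0 \<in> U \<inter> F N -` ball z (\<epsilon> / 4)"
    using \<beta>\<^sub>0 \<open>\<epsilon> > 0\<close> by (simp add: z_def)
  ultimately obtain r where r: "r > 0" "cball \<beta>\<^sub>0 r \<subseteq> U \<inter> F N -` ball z (\<epsilon> / 4)"
    using open_contains_cball by blast
  let ?J = "{\<beta>\<^sub>0 - r..\<beta>\<^sub>0 + r}"
  have J: "?J \<subseteq> U" "\<And>\<beta>. \<beta> \<in> ?J \<Longrightarrow> norm (F N \<beta> - z) \<le> \<epsilon> / 4"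
    using r by (auto simp: cball_eq_atLeastAtMost dist_norm norm_minus_commute
        dest!: subsetD intro!: less_imp_le)
  have close: "norm (F n \<beta> - z) \<le> \<epsilon> / 2" if "n \<ge> N" "\<beta> \<in> ?J" for n \<beta>
  proof -
    have "norm (F n \<beta> - z) \<le> norm (F n \<beta> - F N \<beta>) + norm (F N \<beta> - z)"
      using norm_triangle_ineq[of "F n \<beta> - F N \<beta>" "F N \<beta> - z"] by simp
    also have "\<dots> \<le> \<epsilon> / 4 + \<epsilon> / 4"
      using that J by (intro add_mono Cauchy) auto
    finally show ?thesis by simp
  qed
  have bound: "norm (integral ?J (F n) - 2 * r * z) \<le> \<epsilon> * r" if "n \<ge> N" for n
  proof -
    have int: "F n integrable_on ?J"
      unfolding F_def by (intro integrable_continuous_real continuous_on_weighted_mean)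
    have "integral ?J (F n) - 2 * r * z = integral ?J (\<lambda>\<beta>. F n \<beta> - z)"
      using int \<open>r > 0\<close> by (subst integral_diff) (auto simp: scaleR_conv_of_real)
    also have "norm \<dots> \<le> \<epsilon> / 2 * (\<beta>\<^sub>0 + r - (\<beta>\<^sub>0 - r))"
      unfolding F_def
      by (rule integral_bound) (use r that close in \<open>auto simp: F_def intro!: continuous_intros continuous_on_weighted_mean\<close>)
    finally show ?thesis by simp
  qed
  have "(\<lambda>n. integral ?J (F n)) \<longlonglongrightarrow> 0"
    unfolding F_def using r by (intro integral_weighted_mean_tendsto_0 w s) auto
  from norm_limit_diff_le[OF this bound] have "norm (0 - 2 * r * z) \<le> \<epsilon> * r" .
  then have "2 * norm z \<le> \<epsilon>"
    using r by (simp add: norm_mult)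
  with z \<open>\<epsilon> > 0\<close> show False by linarith
qed

section \<open>Characters of the circle and trigonometric approximation\<close>
lemma circle_cases:
  fixes z :: circle
  obtains x where "z = mod_one x"
  by (metis Quotient3_abs_rep Quotient3_circle)

lemma mod_one_eq_iff: "mod_one x = mod_one y \<longleftrightarrow> x - y \<in> \<int>"
  by (rule circle.abs_eq_iff)

lemma continuous_on_circle_iff:
  fixes f :: "circle \<Rightarrow> 'a::topological_space"
  shows "continuous_on UNIV f \<longleftrightarrow> continuous_on UNIV (\<lambda>x. f (mod_one x))"
  by (simp add: continuous_on_open_vimage open_circle_def vimage_def)

lemma continuous_on_mod_one: "continuous_on UNIV mod_one"
  by (simp add: continuous_on_open_vimage open_circle_def)

definition circle_char :: "int \<Rightarrow> circle \<Rightarrow> complex" where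
  "circle_char k z = unit_exp (of_int k * rep_circle z)"

lemma circle_char_mod_one [simp]: "circle_char k (mod_one x) = unit_exp (of_int k * x)"
proof -
  have "mod_one (rep_circle (mod_one x)) = mod_one x"
    by (metis Quotient3_abs_rep Quotient3_circle)
  then have "rep_circle (mod_one x) - x \<in> \<int>"
    by (simp add: mod_one_eq_iff)
  then have "of_int k * (rep_circle (mod_one x) - x) \<in> \<int>"
    by (intro Ints_mult Ints_of_int)
  then show ?thesis
    by (simp add: circle_char_def unit_exp_eq_iff right_diff_distrib)
qed

lemma circle_char_0 [simp]: "circle_char 0 z = 1"
  by (simp add: circle_char_def)

lemma circle_char_add: "circle_char (j + k) z = circle_char j z * circle_char k z"
  by (simp add: circle_char_def unit_exp_add ring_distribs)

lemma norm_circle_char [simp]: "norm (circle_char k z) = 1"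
  by (simp add: circle_char_def)

lemma circle_char_uminus: "circle_char (- k) z = cnj (circle_char k z)"
  by (simp add: circle_char_def unit_exp_cis cis_cnj)

lemma circle_char_1_eq_iff: "circle_char 1 y = circle_char 1 z \<longleftrightarrow> y = z"
  by (cases y rule: circle_cases, cases z rule: circle_cases)
    (simp add: unit_exp_eq_iff mod_one_eq_iff)

lemma continuous_on_circle_char: "continuous_on UNIV (circle_char k)"
  by (simp add: continuous_on_circle_iff) (intro continuous_intros)

text \<open>The injective continuous map \<open>circle_char 1\<close> into the complex plane pulls back separating
  neighbourhoods. Stone--Weierstrass approximation is available on compact Hausdorff spaces.\<close>

instance circle :: t2_space
proof
  fix y z :: circle
  assume "y \<noteq> z"
  then have "circle_char 1 y \<noteq> circle_char 1 z" by (simp add: circle_char_1_eq_iff)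
  then obtain U V where "open U" "open V" "circle_char 1 y \<in> U" "circle_char 1 z \<in> V" "U \<inter> V = {}"
    by (metis hausdorff)
  then show "\<exists>U V. open U \<and> open V \<and> y \<in> U \<and> z \<in> V \<and> U \<inter> V = {}"
    by (intro exI[of _ "circle_char 1 -` U"] exI[of _ "circle_char 1 -` V"])
      (auto intro!: open_vimage continuous_on_circle_char)
qed

lemma compact_circle: "compact (UNIV :: circle set)"
proof -
  have "z \<in> mod_one ` {0..1}" for z
  proof (cases z rule: circle_cases)
    fix x assume "z = mod_one x"
    then have "z = mod_one (frac x)" by (simp add: mod_one_eq_iff frac_def)
    then show ?thesis using frac_ge_0[of x] frac_lt_1[of x] by (intro image_eqI) auto
  qed
  then have "UNIV = mod_one ` {0..1}" by auto
  moreover have "compact (mod_one ` {0..1})"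
    by (intro compact_continuous_image continuous_on_subset[OF continuous_on_mod_one]) auto
  ultimately show ?thesis by simp
qed

lemma continuous_circle_bounded:
  fixes f :: "circle \<Rightarrow> 'a::real_normed_vector"
  assumes "continuous_on UNIV f"
  obtains B where "\<And>z. norm (f z) \<le> B"
proof -
  have "bounded (range f)"
    using assms compact_circle by (intro compact_imp_bounded compact_continuous_image)
  then show ?thesis using that by (auto simp: bounded_iff)
qed

text \<open>Generating the trigonometric polynomials by monomials and sums avoids bookkeeping of index sets:
  both closure under products and convergence of means follow by induction.\<close>

inductive trig_poly :: "(circle \<Rightarrow> complex) \<Rightarrow> bool" where
  monom: "trig_poly (\<lambda>z. c * circle_char k z)"
| add: "trig_poly f \<Longrightarrow> trig_poly g \<Longrightarrow> trig_poly (\<lambda>z. f z + g z)"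

lemma trig_poly_monom_mult:
  assumes "trig_poly g"
  shows "trig_poly (\<lambda>z. c * circle_char k z * g z)"
  using assms
proof induction
  case (monom d j)
  have "trig_poly (\<lambda>z. (c * d) * circle_char (k + j) z)" by (rule trig_poly.monom)
  then show ?case by (simp add: circle_char_add mult_ac)
next
  case (add f g)
  from trig_poly.add[OF add.IH] show ?case by (simp add: ring_distribs)
qed

lemma trig_poly_mult:
  assumes "trig_poly f" "trig_poly g"
  shows "trig_poly (\<lambda>z. f z * g z)"
  using assms(1)
proof induction
  case (monom c k)
  then show ?case by (rule trig_poly_monom_mult[OF assms(2)])
next
  case (add f h)
  from trig_poly.add[OF add.IH] show ?case by (simp add: ring_distribs)
qed

text \<open>Stone--Weierstrass for the real-valued trigonometric polynomials; points are separated by the real and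
  imaginary parts of the basic character.\<close>

lemma trig_poly_dense:
  fixes f :: "circle \<Rightarrow> real"
  assumes "continuous_on UNIV f" "e > 0"
  obtains g where "trig_poly (\<lambda>z. complex_of_real (g z))" "\<And>z. \<bar>f z - g z\<bar> < e"
proof -
  have const: "trig_poly (\<lambda>z. c)" for c
    using trig_poly.monom[of c 0] by simp
  have *: "trig_poly (\<lambda>z. complex_of_real (Re (circle_char 1 z)))"
    using trig_poly.add[OF trig_poly.monom[of "1/2" 1] trig_poly.monom[of "1/2" "-1"]]
    by (rule back_subst[of trig_poly]) (auto simp: circle_char_uminus complex_eq_iff)
  have **: "trig_poly (\<lambda>z. complex_of_real (Im (circle_char 1 z)))"
    using trig_poly.add[OF trig_poly.monom[of "-\<i>/2" 1] trig_poly.monom[of "\<i>/2" "-1"]]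
    by (rule back_subst[of trig_poly]) (auto simp: circle_char_uminus complex_eq_iff)
  have "\<exists>g. trig_poly (\<lambda>z. complex_of_real (g z)) \<and> (\<forall>z\<in>UNIV. \<bar>f z - g z\<bar> < e)"
  proof (rule Stone_Weierstrass_HOL[OF compact_circle, 
        where P = "\<lambda>g. trig_poly (\<lambda>z. complex_of_real (g z))"])
    fix g :: "circle \<Rightarrow> real" assume "trig_poly (\<lambda>z. complex_of_real (g z))"
    moreover have "continuous_on UNIV h" if "trig_poly h" for h
      using that by induction (auto intro!: continuous_intros continuous_on_circle_char)
    ultimately have "continuous_on UNIV (\<lambda>z. Re (complex_of_real (g z)))"
      by (intro continuous_on_Re)
    then show "continuous_on UNIV g" by simp
  next
    fix y z :: circle assume "y \<in> UNIV \<and> z \<in> UNIV \<and> y \<noteq> z"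
    then have "circle_char 1 y \<noteq> circle_char 1 z" by (simp add: circle_char_1_eq_iff)
    then have "Re (circle_char 1 y) \<noteq> Re (circle_char 1 z) \<or> Im (circle_char 1 y) \<noteq> Im (circle_char 1 z)"
      by (simp add: complex_eq_iff)
    then show "\<exists>f. trig_poly (\<lambda>z. complex_of_real (f z)) \<and> f y \<noteq> f z"
      using exI[of "\<lambda>f. trig_poly (\<lambda>z. complex_of_real (f z)) \<and> f y \<noteq> f z", OF conjI[OF *]]
        exI[of "\<lambda>f. trig_poly (\<lambda>z. complex_of_real (f z)) \<and> f y \<noteq> f z", OF conjI[OF **]] by blast
  qed (use assms const trig_poly.add trig_poly_mult in auto)
  then show ?thesis using that by blast
qed

lemma mean_trig_poly_convergent:
  assumes "good s" "trig_poly g"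
  shows "convergent (\<lambda>N. (1 / of_nat N) * (\<Sum>n=1..N. g (mod_one (of_nat (s n) * \<alpha>))))"
  using assms(2)
proof induction
  case (monom c k)
  have "convergent (\<lambda>N. (1 / of_nat N) * (\<Sum>n=1..N. unit_exp (of_nat (s n) * (of_int k * \<alpha>))))"
    using assms(1) by (simp only: good_def)
  from convergent_mult[OF convergent_const this]
  have "convergent (\<lambda>N. c * ((1 / of_nat N) * (\<Sum>n=1..N. unit_exp (of_nat (s n) * (of_int k * \<alpha>)))))" .
  then show ?case
    by (simp add: sum_distrib_left mult_ac)
next
  case (add f g)
  from convergent_add[OF add.IH] show ?case
    by (simp add: sum.distrib ring_distribs)
qed

text \<open>Goodness gives convergence for characters, hence for trigonometric polynomials, and uniform
  approximation transfers the Cauchy property to every continuous function.\<close>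

lemma mean_continuous_convergent:
  fixes f :: "circle \<Rightarrow> real"
  assumes "good s" "continuous_on UNIV f"
  shows "convergent (\<lambda>N. (1 / of_nat N) * (\<Sum>n=1..N. f (mod_one (of_nat (s n) * \<alpha>))))"
proof -
  define A where "A f N = (1 / of_nat N) * (\<Sum>n=1..N. f (mod_one (of_nat (s n) * \<alpha>)))"
    for f :: "circle \<Rightarrow> real" and N
  have "Cauchy (A f)"
  proof (rule CauchyI)
    fix e :: real assume "e > 0"
    then obtain g where g: "trig_poly (\<lambda>z. complex_of_real (g z))" "\<And>z. \<bar>f z - g z\<bar> < e / 3"
      using trig_poly_dense[OF assms(2), of "e / 3"] by auto
    have close: "\<bar>A f N - A g N\<bar> \<le> e / 3" for N
    proof -
      have "A f N - A g N = (1 / of_nat N) * (\<Sum>n=1..N. f (mod_one (of_nat (s n) * \<alpha>)) - g (mod_one (of_nat (s n) * \<alpha>)))"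
        by (simp add: A_def sum_subtractf right_diff_distrib)
      also have "\<bar>\<dots>\<bar> \<le> (1 / of_nat N) * (\<Sum>n=1..N. e / 3)"
        unfolding abs_mult using g(2)
        by (intro mult_mono order_trans[OF sum_abs sum_mono]) (auto intro: less_imp_le)
      also have "\<dots> \<le> e / 3" using \<open>e > 0\<close> by simp
      finally show ?thesis .
    qed
    obtain L where "(\<lambda>N. complex_of_real (A g N)) \<longlonglongrightarrow> L"
      using mean_trig_poly_convergent[OF assms(1) g(1), of \<alpha>] by (auto simp: A_def convergent_def)
    from tendsto_Re[OF this] have "Cauchy (A g)"
      by (simp add: LIMSEQ_imp_Cauchy)
    then obtain M where M: "\<bar>A g m - A g n\<bar> < e / 3" if "m \<ge> M" "n \<ge> M" for m n
      using CauchyD[of "A g" "e / 3"] \<open>e > 0\<close> by auto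
    show "\<exists>M. \<forall>m\<ge>M. \<forall>n\<ge>M. norm (A f m - A f n) < e"
    proof (intro exI allI impI)
      fix m n assume "m \<ge> M" "n \<ge> M"
      then show "norm (A f m - A f n) < e"
        using M[of m n] close[of m] close[of n]
        unfolding real_norm_def abs_le_iff abs_less_iff by linarith
    qed
  qed
  then show ?thesis by (simp add: Cauchy_convergent_iff A_def[abs_def])
qed

section \<open>Existence and uniqueness of the limit measure\<close>

lemma borel_measurable_mod_one [measurable]: "mod_one \<in> borel_measurable borel"
  by (intro borel_measurable_continuous_onI continuous_on_mod_one)

text \<open>The empirical measures lift to measures on the real line concentrated on \<open>[0, 1)\<close>, a tight sequence. A weak
  limit along a subsequence, pushed down to the circle, has the right integrals for continuous functions
  because the full sequence of means is already known to converge. Nothing is lost at the endpoints, since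
  the test functions on the line are periodic.\<close>

lemma limit_measure_exists:
  assumes "good s"
  shows "\<exists>\<mu>. prob_space \<mu> \<and> sets \<mu> = sets borel \<and> converges_weakly (empirical_measure s \<alpha>) \<mu>"
proof -
  \<comment> \<open>The index is shifted because the empirical measure for \<open>N = 0\<close> is not a probability measure.\<close>
  define \<nu> :: "nat \<Rightarrow> real measure" where
    "\<nu> N = distr (uniform_count_measure {1..Suc N}) borel (\<lambda>n. frac (of_nat (s n) * \<alpha>))" for N
  have prob: "prob_space (uniform_count_measure {1..Suc N})" for N
    by (intro prob_space_uniform_count_measure) auto
  have meas: "f \<in> measurable (uniform_count_measure A) borel" for f :: "nat \<Rightarrow> real" and A
    by (simp add: measurable_def space_uniform_count_measure sets_uniform_count_measure)
  have \<nu>: "real_distribution (\<nu> N)" for N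
    unfolding real_distribution_def real_distribution_axioms_def \<nu>_def
    by (intro conjI prob_space.prob_space_distr prob meas) auto
  have "measure (\<nu> N) {-1<..1} = 1" for N
  proof -
    interpret prob_space "uniform_count_measure {1..Suc N}" by (rule prob)
    \<comment> \<open>Tightness is phrased with half-open intervals excluding the left end, hence -1 and not 0.\<close>
    have "-1 < frac x \<and> frac x \<le> 1" for x :: real
      using frac_ge_0[of x] frac_lt_1[of x] by linarith
    then have UNIV: "(\<lambda>n. frac (of_nat (s n) * \<alpha>)) -` {-1<..1} = UNIV"
      by auto
    have "measure (\<nu> N) {-1<..1} = prob ((\<lambda>n. frac (of_nat (s n) * \<alpha>)) -` {-1<..1} \<inter> space (uniform_count_measure {1..Suc N}))"
      unfolding \<nu>_def by (rule measure_distr[OF meas]) simp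
    then show ?thesis by (simp only: UNIV Int_UNIV_left prob_space)
  qed
  then have "tight \<nu>"
    unfolding tight_def using \<nu> by (intro conjI allI impI exI[of _ "-1"] exI[of _ 1]) auto
  from tight_imp_convergent_subsubsequence[OF this strict_mono_id]
  obtain r M where r: "strict_mono r" and M: "real_distribution M" and conv: "weak_conv_m (\<nu> \<circ> r) M"
    by auto
  interpret M: real_distribution M by fact
  have "converges_weakly (empirical_measure s \<alpha>) (distr M borel mod_one)"
    unfolding converges_weakly_def
  proof (intro allI impI)
    fix f :: "circle \<Rightarrow> real" assume f: "continuous_on UNIV f"
    define A where "A N = (1 / of_nat N) * (\<Sum>n=1..N. f (mod_one (of_nat (s n) * \<alpha>)))" for N
    obtain L where L: "A \<longlonglongrightarrow> L"
      using mean_continuous_convergent[OF assms f, of \<alpha>] unfolding convergent_def A_def by auto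
    obtain B where B: "\<And>z. norm (f z) \<le> B"
      using continuous_circle_bounded[OF f] by blast
    have f': "isCont (\<lambda>x. f (mod_one x)) x" for x
      using f by (simp add: continuous_on_circle_iff continuous_on_eq_continuous_at)
    have fm: "f \<in> borel_measurable borel"
      using f by (rule borel_measurable_continuous_onI)
    have "(\<lambda>k. \<integral>x. f (mod_one x) \<partial>(\<nu> \<circ> r) k) \<longlonglongrightarrow> (\<integral>x. f (mod_one x) \<partial>M)"
      by (rule weak_conv_imp_integral_bdd_continuous_conv[OF _ M conv f' B]) (simp add: \<nu>)
    moreover have "(\<integral>x. f (mod_one x) \<partial>(\<nu> \<circ> r) k) = A (Suc (r k))" for k
    proof -
      have "(\<integral>x. f (mod_one x) \<partial>\<nu> N) = (\<integral>n. f (mod_one (frac (of_nat (s n) * \<alpha>))) \<partial>uniform_count_measure {1..Suc N})" for N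
        unfolding \<nu>_def by (intro integral_distr meas measurable_compose[OF borel_measurable_mod_one fm])
      also have "\<dots> N = A (Suc N)" for N
      proof -
        have "mod_one (frac x) = mod_one x" for x by (simp add: mod_one_eq_iff frac_def)
        then show ?thesis by (simp add: A_def integral_uniform_count_measure)
      qed
      finally show ?thesis by simp
    qed
    moreover have "(\<lambda>k. A (Suc (r k))) \<longlonglongrightarrow> L"
      using LIMSEQ_subseq_LIMSEQ[OF LIMSEQ_Suc[OF L] r] by (simp add: o_def)
    ultimately have "L = (\<integral>x. f (mod_one x) \<partial>M)"
      by (simp add: LIMSEQ_unique)
    also have "\<dots> = (\<integral>x. f x \<partial>distr M borel mod_one)"
      by (intro integral_distr[symmetric] fm) simp
    finally show "(\<lambda>N. \<integral>x. f x \<partial>empirical_measure s \<alpha> N) \<longlonglongrightarrow> (\<integral>x. f x \<partial>distr M borel mod_one)"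
      using L unfolding integral_empirical_measure[OF f] A_def by simp
  qed
  moreover have "prob_space (distr M borel mod_one)"
    by (intro M.prob_space_distr) simp
  ultimately show ?thesis by (intro exI[of _ "distr M borel mod_one"]) simp
qed

text \<open>The indicator of the complement of a closed set \<open>K\<close> is the limit of the continuous functions
  \<open>min 1 (k * d)\<close>, where \<open>d\<close> is the distance to \<open>K\<close> measured in the plane through the embedding
  \<open>circle_char 1\<close>. Hence integrals of continuous functions determine the measure on the intersection-stable
  family of open sets, which generates the Borel sets.\<close>

lemma measure_circle_eqI:
  fixes \<mu> \<nu> :: "circle measure"
  assumes "finite_measure \<mu>" "finite_measure \<nu>"
    and sets: "sets \<mu> = sets borel" "sets \<nu> = sets borel"
    and eq: "\<And>f :: circle \<Rightarrow> real. continuous_on UNIV f \<Longrightarrow> integral\<^sup>L \<mu> f = integral\<^sup>L \<nu> f"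
  shows "\<mu> = \<nu>"
proof -
  have lim: "(\<lambda>k. \<integral>x. min 1 (real k * infdist (circle_char 1 x) (circle_char 1 ` K)) \<partial>M) \<longlonglongrightarrow> measure M (- K)"
    if M: "finite_measure M" "sets M = sets borel" and K: "closed K" "K \<noteq> {}" for M K
  proof -
    interpret finite_measure M by fact
    have "compact (circle_char 1 ` K)"
      using K compact_circle
      by (intro compact_continuous_image continuous_on_subset[OF continuous_on_circle_char])
        (auto intro: compact_Int_closed[of UNIV K, simplified])
    then have cl: "closed (circle_char 1 ` K)" by (rule compact_imp_closed)
    have "(\<lambda>k. \<integral>x. min 1 (real k * infdist (circle_char 1 x) (circle_char 1 ` K)) \<partial>M) \<longlonglongrightarrow> (\<integral>x. indicator (- K) x \<partial>M)"
    proof (rule integral_dominated_convergence[where w = "\<lambda>_. 1"])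
      show "(\<lambda>x. min 1 (real k * infdist (circle_char 1 x) (circle_char 1 ` K))) \<in> borel_measurable M" for k
        unfolding measurable_cong_sets[OF M(2) refl]
        by (intro borel_measurable_continuous_onI continuous_intros continuous_on_circle_char)
      have "- K \<in> sets borel" using K by auto
      then show "indicator (- K) \<in> borel_measurable M"
        unfolding measurable_cong_sets[OF M(2) refl] by (rule borel_measurable_indicator)
      have "(\<lambda>k. min 1 (real k * infdist (circle_char 1 x) (circle_char 1 ` K))) \<longlonglongrightarrow> indicator (- K) x" for x
      proof (cases "x \<in> K")
        case True
        then show ?thesis by simp
      next
        case False
        then have "circle_char 1 x \<notin> circle_char 1 ` K" by (auto simp: circle_char_1_eq_iff)
        then have "infdist (circle_char 1 x) (circle_char 1 ` K) > 0"
          using cl K by (metis in_closed_iff_infdist_zero image_is_empty infdist_nonneg less_eq_real_def)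
        then have "\<forall>\<^sub>F k in sequentially. min 1 (real k * infdist (circle_char 1 x) (circle_char 1 ` K)) = 1"
          by (intro eventually_mono[OF eventually_ge_at_top[of "nat \<lceil>1 / infdist (circle_char 1 x) (circle_char 1 ` K)\<rceil>"]])
            (auto simp: field_simps min_def nat_le_iff ceiling_le_iff)
        then show ?thesis using False by (simp add: tendsto_eventually)
      qed
      then show "AE x in M. (\<lambda>k. min 1 (real k * infdist (circle_char 1 x) (circle_char 1 ` K))) \<longlonglongrightarrow> indicator (- K) x"
        by simp
      have "0 \<le> real k * infdist (circle_char 1 x) (circle_char 1 ` K)" for k x
        by (simp add: infdist_nonneg)
      then have "norm (min 1 (real k * infdist (circle_char 1 x) (circle_char 1 ` K))) \<le> 1" for k x
        by (simp add: min_def)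
      then show "AE x in M. norm (min 1 (real k * infdist (circle_char 1 x) (circle_char 1 ` K))) \<le> 1" for k
        by simp
    qed auto
    moreover have "(\<integral>x. indicator (- K) x \<partial>M) = measure M (- K)"
      using K M(2) by (simp add: borel_closed sets_eq_imp_space_eq)
    ultimately show ?thesis by simp
  qed
  interpret \<mu>: finite_measure \<mu> by fact
  interpret \<nu>: finite_measure \<nu> by fact
  have total: "measure \<mu> UNIV = measure \<nu> UNIV"
    using eq[of "\<lambda>_. 1"] sets by (simp add: sets_eq_imp_space_eq)
  show ?thesis
  proof (rule measure_eqI_generator_eq[where E = "{U. open U}" and \<Omega> = UNIV and A = "\<lambda>_. UNIV"])
    fix U :: "circle set" assume "U \<in> {U. open U}"
    then have U: "closed (- U)" by auto
    show "emeasure \<mu> U = emeasure \<nu> U"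
    proof (cases "U = UNIV")
      case True
      then show ?thesis using total by (simp add: \<mu>.emeasure_eq_measure \<nu>.emeasure_eq_measure)
    next
      case False
      then have ne: "- U \<noteq> {}" by auto
      have "(\<integral>x. min 1 (real k * infdist (circle_char 1 x) (circle_char 1 ` (- U))) \<partial>\<mu>) = (\<integral>x. min 1 (real k * infdist (circle_char 1 x) (circle_char 1 ` (- U))) \<partial>\<nu>)" for k
        by (intro eq continuous_intros continuous_on_circle_char)
      then have "measure \<mu> (- (- U)) = measure \<nu> (- (- U))"
        using lim[OF assms(1) sets(1) U ne] lim[OF assms(2) sets(2) U ne] by (intro LIMSEQ_unique) simp_all
      then show ?thesis by (simp add: \<mu>.emeasure_eq_measure \<nu>.emeasure_eq_measure)
    qed
  qed (auto simp: sets borel_def Int_stable_def \<mu>.emeasure_eq_measure)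
qed

text \<open>Existence and uniqueness together make the definite description denote; everything below uses the limit
  measure only through these properties.\<close>

lemma limit_measure_props:
  assumes "good s"
  shows "prob_space (limit_measure s \<alpha>)" "sets (limit_measure s \<alpha>) = sets borel"
    "converges_weakly (empirical_measure s \<alpha>) (limit_measure s \<alpha>)"
proof -
  have "\<exists>!\<mu>. prob_space \<mu> \<and> sets \<mu> = sets borel \<and> converges_weakly (empirical_measure s \<alpha>) \<mu>"
  proof (rule ex_ex1I[OF limit_measure_exists[OF assms]])
    fix \<mu> \<nu> :: "circle measure"
    assume \<mu>: "prob_space \<mu> \<and> sets \<mu> = sets borel \<and> converges_weakly (empirical_measure s \<alpha>) \<mu>"
      and \<nu>: "prob_space \<nu> \<and> sets \<nu> = sets borel \<and> converges_weakly (empirical_measure s \<alpha>) \<nu>"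
    show "\<mu> = \<nu>"
    proof (rule measure_circle_eqI)
      fix f :: "circle \<Rightarrow> real" assume "continuous_on UNIV f"
      then show "integral\<^sup>L \<mu> f = integral\<^sup>L \<nu> f"
        using \<mu> \<nu> unfolding converges_weakly_def by (meson LIMSEQ_unique)
    qed (use \<mu> \<nu> prob_space.finite_measure in auto)
  qed
  from theI'[OF this] 
  show "prob_space (limit_measure s \<alpha>)" "sets (limit_measure s \<alpha>) = sets borel"
    "converges_weakly (empirical_measure s \<alpha>) (limit_measure s \<alpha>)"
    unfolding limit_measure_def by auto
qed

lemma integrable_continuous_circle:
  fixes f :: "circle \<Rightarrow> 'a::{banach, second_countable_topology}"
  assumes "finite_measure \<mu>" "sets \<mu> = sets borel" "continuous_on UNIV f"
  shows "integrable \<mu> f"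
proof -
  interpret finite_measure \<mu> by fact
  obtain B where "\<And>z. norm (f z) \<le> B"
    using continuous_circle_bounded[OF assms(3)] by blast
  moreover have "f \<in> borel_measurable \<mu>"
    unfolding measurable_cong_sets[OF assms(2) refl]
    using assms(3) by (rule borel_measurable_continuous_onI)
  ultimately show ?thesis by (intro integrable_const_bound[where B = B]) auto
qed

lemma mean_tendsto_integral_limit_measure:
  fixes f :: "circle \<Rightarrow> complex"
  assumes "good s" and f: "continuous_on UNIV f"
  shows "(\<lambda>N. (1 / of_nat N) * (\<Sum>n=1..N. f (mod_one (of_nat (s n) * \<alpha>))))
           \<longlonglongrightarrow> integral\<^sup>L (limit_measure s \<alpha>) f"
proof -
  note lm = limit_measure_props[OF assms(1), of \<alpha>]
  have int: "integrable (limit_measure s \<alpha>) f"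
    by (intro integrable_continuous_circle lm prob_space.finite_measure f)
  have lim: "(\<lambda>N. (1 / of_nat N) * (\<Sum>n=1..N. g (mod_one (of_nat (s n) * \<alpha>))))
           \<longlonglongrightarrow> integral\<^sup>L (limit_measure s \<alpha>) g" if "continuous_on UNIV g" for g :: "circle \<Rightarrow> real"
    using lm(3) that unfolding converges_weakly_def by (simp add: integral_empirical_measure)
  then show ?thesis
    unfolding tendsto_complex_iff
    using lim[of "\<lambda>z. Re (f z)"] lim[of "\<lambda>z. Im (f z)"] int f
    by (auto simp: continuous_on_Re continuous_on_Im Re_divide_of_nat Im_divide_of_nat)
qed

section \<open>Isolating an atom\<close>

text \<open>The normalised one-sided Dirichlet kernel of length \<open>K\<close> centred at \<open>c\<close>: a trigonometric polynomial of
  modulus at most 1 that tends pointwise to the indicator of the single point \<open>mod_one c\<close>.\<close>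
definition peak :: "real \<Rightarrow> nat \<Rightarrow> circle \<Rightarrow> complex" where
  "peak c K z = (1 / of_nat K) * (\<Sum>j<K. unit_exp (- (of_nat j * c)) * circle_char (int j) z)"

lemma continuous_on_peak: "continuous_on UNIV (peak c K)"
  unfolding peak_def by (intro continuous_intros continuous_on_circle_char)

lemma norm_peak_le_1: "norm (peak c K z) \<le> 1"
proof -
  have "norm (\<Sum>j<K. unit_exp (- (of_nat j * c)) * circle_char (int j) z) \<le> of_nat (card {..<K}) * 1"
    by (intro sum_norm_bound) (simp add: norm_mult)
  then show ?thesis
    by (cases "K = 0") (simp_all add: peak_def norm_mult norm_divide field_simps)
qed

lemma peak_mod_one:
  "peak c K (mod_one x) = (1 / of_nat K) * (\<Sum>j<K. unit_exp (x - c) ^ j)"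
  by (simp add: peak_def unit_exp_of_nat_mult[symmetric] unit_exp_add[symmetric] algebra_simps)

lemma peak_tendsto_indicator:
  "(\<lambda>K. peak c K z) \<longlonglongrightarrow> indicator {mod_one c} z"
proof (cases z rule: circle_cases)
  fix x assume z: "z = mod_one x"
  define w where "w = unit_exp (x - c)"
  show ?thesis
  proof (cases "w = 1")
    case True
    then have "z = mod_one c"
      by (simp add: w_def z mod_one_eq_iff unit_exp_eq_1_iff)
    moreover have "\<forall>\<^sub>F K in sequentially. peak c K z = 1"
      using eventually_gt_at_top[of 0]
      by eventually_elim (use True in \<open>simp add: z peak_mod_one w_def\<close>)
    ultimately show ?thesis by (simp add: tendsto_eventually)
  next
    case False
    then have "z \<noteq> mod_one c"
      by (simp add: w_def z mod_one_eq_iff unit_exp_eq_1_iff)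
    moreover have "(\<lambda>K. peak c K z) \<longlonglongrightarrow> 0"
    proof (rule Lim_null_comparison[OF always_eventually], rule allI)
      fix K
      have "norm (\<Sum>j<K. w ^ j) = norm (w ^ K - 1) / norm (w - 1)"
        using False by (simp add: geometric_sum norm_divide)
      also have "\<dots> \<le> 2 / norm (w - 1)"
        using norm_triangle_ineq4[of "w ^ K" 1]
        by (intro divide_right_mono) (auto simp: norm_power w_def)
      finally show "norm (peak c K z) \<le> (1 / real K) * (2 / norm (w - 1))"
        unfolding z peak_mod_one w_def[symmetric] norm_mult
        by (intro mult_mono) (auto simp: norm_divide)
      show "(\<lambda>K. (1 / real K) * (2 / norm (w - 1))) \<longlonglongrightarrow> 0"
        by (intro tendsto_mult_left_zero lim_1_over_n)
    qed
    ultimately show ?thesis by simp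
  qed
qed

lemma integral_peak_minus_indicator_tendsto_0:
  assumes "finite_measure \<mu>" "sets \<mu> = sets borel"
  shows "(\<lambda>K. \<integral>z. norm (peak c K z - indicator {mod_one c} z) \<partial>\<mu>) \<longlonglongrightarrow> 0"
proof -
  interpret finite_measure \<mu> by fact
  have [measurable]: "peak c K \<in> borel_measurable \<mu>" for K
    unfolding measurable_cong_sets[OF assms(2) refl]
    by (intro borel_measurable_continuous_onI continuous_on_peak)
  have [measurable]: "{mod_one c} \<in> sets \<mu>"
    using closed_circle_singleton by (simp add: assms(2) borel_closed)
  have "(\<lambda>K. \<integral>z. norm (peak c K z - indicator {mod_one c} z) \<partial>\<mu>) \<longlonglongrightarrow> (\<integral>z. 0 \<partial>\<mu>)"
  proof (rule integral_dominated_convergence[where w = "\<lambda>_. 2"])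
    have "(\<lambda>K. norm (peak c K z - indicator {mod_one c} z)) \<longlonglongrightarrow> 0" for z
      using peak_tendsto_indicator[of c z] by (simp add: LIM_zero tendsto_norm_zero)
    then show "AE z in \<mu>. (\<lambda>K. norm (peak c K z - indicator {mod_one c} z)) \<longlonglongrightarrow> 0"
      by simp
    have "norm (peak c K z - indicator {mod_one c} z) \<le> 2" for K z
      using norm_triangle_ineq4[of "peak c K z" "indicator {mod_one c} z"] norm_peak_le_1[of c K z]
      by (auto simp: indicator_def split: if_splits)
    then show "AE z in \<mu>. norm (norm (peak c K z - indicator {mod_one c} z)) \<le> 2" for K
      by simp
  qed auto
  then show ?thesis by simp
qed

text \<open>A character is constant on a single point, so multiplying by it only rotates the mass of the atom. The
  resulting lower bound does not depend on the frequency \<open>k\<close>; this uniformity is what makes the argument work.\<close>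

lemma norm_integral_peak_char_ge:
  assumes "prob_space \<mu>" "sets \<mu> = sets borel"
  shows "norm (\<integral>z. peak c K z * circle_char k z \<partial>\<mu>)
    \<ge> measure \<mu> {mod_one c} - (\<integral>z. norm (peak c K z - indicator {mod_one c} z) \<partial>\<mu>)"
proof -
  interpret prob_space \<mu> by fact
  let ?\<gamma> = "mod_one c"
  have [measurable]: "{?\<gamma>} \<in> sets \<mu>"
    using closed_circle_singleton by (simp add: assms(2) borel_closed)
  have int: "integrable \<mu> (\<lambda>z. peak c K z * circle_char k z)"
    by (intro integrable_continuous_circle finite_measure_axioms assms(2) continuous_on_mult
        continuous_on_peak continuous_on_circle_char)
  have ind: "indicator {?\<gamma>} z * circle_char k z = indicator {?\<gamma>} z * circle_char k ?\<gamma>" for z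
    by (simp add: indicator_def)
  have "(\<integral>z. indicator {?\<gamma>} z * circle_char k z \<partial>\<mu>) = measure \<mu> {?\<gamma>} * circle_char k ?\<gamma>"
    unfolding ind using integral_complex_of_real[of \<mu> "indicator {?\<gamma>}"]
    by (simp add: sets_eq_imp_space_eq[OF assms(2)] of_real_indicator)
  then have "measure \<mu> {?\<gamma>} = norm (\<integral>z. indicator {?\<gamma>} z * circle_char k z \<partial>\<mu>)"
    by (simp add: norm_mult)
  also have "\<dots> \<le> norm (\<integral>z. peak c K z * circle_char k z \<partial>\<mu>)
      + norm (\<integral>z. peak c K z * circle_char k z - indicator {?\<gamma>} z * circle_char k z \<partial>\<mu>)"
  proof -
    have "integrable \<mu> (\<lambda>z. indicator {?\<gamma>} z * circle_char k z)"
      unfolding ind by (auto intro: integrable_const_bound[where B = 1] simp: norm_mult indicator_def)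
    then show ?thesis
      using int norm_triangle_sub[of "\<integral>z. indicator {?\<gamma>} z * circle_char k z \<partial>\<mu>"
          "\<integral>z. peak c K z * circle_char k z \<partial>\<mu>"]
      by (subst Bochner_Integration.integral_diff) (auto simp: norm_minus_commute)
  qed
  also have "norm (\<integral>z. peak c K z * circle_char k z - indicator {?\<gamma>} z * circle_char k z \<partial>\<mu>)
      \<le> (\<integral>z. norm (peak c K z * circle_char k z - indicator {?\<gamma>} z * circle_char k z) \<partial>\<mu>)"
    by (rule integral_norm_bound)
  also have "\<dots> = (\<integral>z. norm (peak c K z - indicator {?\<gamma>} z) \<partial>\<mu>)"
    by (simp add: left_diff_distrib[symmetric] norm_mult)
  finally show ?thesis by linarith
qed

lemma increasing_pos_seq_ge:
  assumes "increasing_pos_seq s" "n \<ge> 1"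
  shows "n \<le> s n"
  using assms(2)
proof (induction n rule: nat_induct_at_least)
  case base
  then show ?case using assms(1) by (auto simp: increasing_pos_seq_def Suc_le_eq)
next
  case (Suc n)
  have "s n < s (Suc n)"
    using assms(1) Suc.hyps by (auto simp: increasing_pos_seq_def strict_mono_on_def)
  with Suc.IH show ?case by simp
qed

lemma dense_multiples_mod_1:
  fixes \<alpha> :: real
  assumes "\<alpha> \<notin> \<rat>"
  shows "closure {of_int k * \<alpha> - of_int h |k h. True} = UNIV"
proof -
  have "x \<in> closure {of_int k * \<alpha> - of_int h |k h. True}" for x
    unfolding closure_approachable dist_real_def
  proof (intro allI impI)
    fix e :: real assume "e > 0"
    then obtain h k where "\<bar>of_int k * \<alpha> - of_int h - x\<bar> < e"
      using sequence_of_fractional_parts_is_dense[OF assms] by metis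
    then show "\<exists>y\<in>{of_int k * \<alpha> - of_int h |k h. True}. \<bar>y - x\<bar> < e" by blast
  qed
  then show ?thesis by auto
qed

section \<open>Continuity of the limit measure\<close>

text \<open>Expanding the kernel turns the weighted mean at \<open>\<beta>\<close> into a finite combination of the plain exponential
  means at \<open>j * \<alpha> + \<beta>\<close>. This uses goodness at every real number, not only at multiples of \<open>\<alpha>\<close>.\<close>

lemma weighted_mean_peak_convergent:
  assumes "good s"
  shows "convergent (\<lambda>N. weighted_mean (\<lambda>n. peak c K (mod_one (of_nat (s n) * \<alpha>))) s N \<beta>)"
proof -
  define E where "E j N = (1 / of_nat N) * (\<Sum>n=1..N. unit_exp (of_nat (s n) * (of_nat j * \<alpha> + \<beta>)))" for j N
  have "weighted_mean (\<lambda>n. peak c K (mod_one (of_nat (s n) * \<alpha>))) s N \<beta>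
      = (\<Sum>j<K. ((1 / of_nat K) * unit_exp (- (of_nat j * c))) * E j N)" for N
  proof -
    have "weighted_mean (\<lambda>n. peak c K (mod_one (of_nat (s n) * \<alpha>))) s N \<beta>
      = (\<Sum>n=1..N. \<Sum>j<K. (1 / of_nat K) * unit_exp (- (of_nat j * c)) * ((1 / of_nat N) * unit_exp (of_nat (s n) * (of_nat j * \<alpha> + \<beta>))))"
      by (simp add: weighted_mean_def peak_def sum_distrib_left sum_distrib_right unit_exp_add ring_distribs mult_ac)
    also have "\<dots> = (\<Sum>j<K. ((1 / of_nat K) * unit_exp (- (of_nat j * c))) * E j N)"
      by (subst sum.swap) (simp add: E_def sum_distrib_left mult.assoc)
    finally show ?thesis .
  qed
  moreover have "convergent (E j)" for j
    using assms unfolding good_def E_def by blast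
  ultimately show ?thesis
    by (simp only:) (intro convergent_sum convergent_mult[OF convergent_const])
qed

text \<open>Integer shifts of the frequency are invisible since the \<open>s n\<close> are integers. At \<open>k * \<alpha>\<close> the exponential
  factor is a character evaluated along the sequence, so the limit is an integral against the limit measure.\<close>

lemma weighted_mean_peak_tendsto:
  assumes "good s"
  shows "(\<lambda>N. weighted_mean (\<lambda>n. peak c K (mod_one (of_nat (s n) * \<alpha>))) s N (of_int k * \<alpha> - of_int h))
    \<longlonglongrightarrow> (\<integral>z. peak c K z * circle_char k z \<partial>limit_measure s \<alpha>)"
proof -
  have "unit_exp (of_nat (s n) * (of_int k * \<alpha> - of_int h)) = circle_char k (mod_one (of_nat (s n) * \<alpha>))" for n
    by (simp add: unit_exp_eq_iff algebra_simps)
  then show ?thesis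
    using mean_tendsto_integral_limit_measure[OF assms, of "\<lambda>z. peak c K z * circle_char k z" \<alpha>]
    by (simp add: weighted_mean_def continuous_on_mult continuous_on_peak continuous_on_circle_char)
qed

theorem mainTheorem2:
  fixes S :: "nat \<Rightarrow> nat" and \<alpha> :: real
  assumes "increasing_pos_seq S"
    and "good S"
    and "\<alpha> \<notin> \<rat>"
  shows "\<forall>\<gamma>::circle. emeasure (limit_measure S \<alpha>) {\<gamma>} = 0"
proof (rule allI, rule ccontr)
  fix \<gamma> :: circle
  let ?\<mu> = "limit_measure S \<alpha>"
  interpret prob_space ?\<mu> by (rule limit_measure_props[OF assms(2)])
  note sets = limit_measure_props(2)[OF assms(2), of \<alpha>]
  obtain c where \<gamma>: "\<gamma> = mod_one c" by (rule circle_cases)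
  define a where "a = prob {\<gamma>}"
  assume "emeasure ?\<mu> {\<gamma>} \<noteq> 0"
  then have "a > 0" by (simp add: a_def emeasure_eq_measure zero_less_measure_iff)
  then have "\<forall>\<^sub>F K in sequentially. (\<integral>z. norm (peak c K z - indicator {\<gamma>} z) \<partial>?\<mu>) < a / 2"
    unfolding \<gamma> by (intro order_tendstoD(2)[OF integral_peak_minus_indicator_tendsto_0] sets finite_measure_axioms) simp
  then obtain K where K: "(\<integral>z. norm (peak c K z - indicator {\<gamma>} z) \<partial>?\<mu>) < a / 2"
    by (auto simp: eventually_sequentially)
  define w where "w n = peak c K (mod_one (of_nat (S n) * \<alpha>))" for n
  have "\<exists>\<beta>\<in>{of_int k * \<alpha> - of_int h |k h. True}. norm (lim (\<lambda>N. weighted_mean w S N \<beta>)) < a / 2"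
  proof (rule weighted_mean_limit_small_on_dense)
    show "norm (w n) \<le> 1" for n
      by (simp add: w_def norm_peak_le_1)
    show "n \<le> S n" if "n \<ge> 1" for n
      using assms(1) that by (rule increasing_pos_seq_ge)
    show "convergent (\<lambda>N. weighted_mean w S N \<beta>)" for \<beta>
      unfolding w_def by (rule weighted_mean_peak_convergent[OF assms(2)])
    show "closure {of_int k * \<alpha> - of_int h |k h. True} = UNIV"
      by (rule dense_multiples_mod_1[OF assms(3)])
  qed (use \<open>a > 0\<close> in simp)
  then obtain k h where "norm (lim (\<lambda>N. weighted_mean w S N (of_int k * \<alpha> - of_int h))) < a / 2"
    by blast
  also have "lim (\<lambda>N. weighted_mean w S N (of_int k * \<alpha> - of_int h)) = (\<integral>z. peak c K z * circle_char k z \<partial>?\<mu>)"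
    unfolding w_def by (rule limI[OF weighted_mean_peak_tendsto[OF assms(2)]])
  finally show False
    using norm_integral_peak_char_ge[OF prob_space_axioms sets, of c K k] K
    unfolding a_def \<gamma> by linarith
qed

end
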